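(* $(\mathcal{C}^N,\odot)$ is an Abelian group with identity element $\mathbf{1}_N\mathbf{1}_N^T$ (the $N\times N$ all-ones matrix), where $\odot$ is the Hadamard (entrywise) product.
   Context: The set $\mathcal{C}_L^N$ of L-CoLT (lower-collinear triangular) matrices consists of all $M=[m_{i,j}]\in\mathbb{R}^{N\times N}$ with $m_{i,j}=0$ for $i<j$ and $m_{i+1,j}/m_{i,j}=r_i$ for $j\le i$ (with $i\le N-1$), for some vector $\boldsymbol{r}\in(\mathbb{R}\setminus\{0\})^{N-1}$. The set $\mathcal{C}_U^N$ of U-CoLT (upper-collinear triangular) matrices consists of all $M=[m_{i,j}]\in\mathbb{R}^{N\times N}$ with $m_{i,j}=0$ for $i\ge j$ and $m_{i-1,j}/m_{i,j}=r'_{i-1}$ for $i<j$ (with $i\ge2$), for some vector $\boldsymbol{r}'\in(\mathbb{R}\setminus\{0\})^{N-2}$. $\mathcal{C}^N=\mathcal{C}_L^N+\mathcal{C}_U^N=\{A+B : A\in\mathcal{C}_L^N,\ B\in\mathcal{C}_U^N\}$.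
   Formalization: All entries m_{i,j} with j≤i of an L-CoLT matrix and with i<j of a U-CoLT matrix are required to be nonzero; the ratio conditions alone leave m_{N,N} and m_{1,2} free to vanish, and such matrices have no Hadamard inverse. *)

theory Defs
  imports "Jordan_Normal_Form.Matrix"
begin

text \<open>
  Indices are 0-based: \<open>M $$ (i, j)\<close> is the entry \<open>m\<close> with subscripts \<open>i + 1, j + 1\<close>.

  The ratio conditions force the entries they mention to be nonzero, but they never mention the
  bottom right entry of a lower matrix nor the entry \<open>(0, 1)\<close> of an upper matrix. These
  two must be nonzero as well, since otherwise the matrix has no Hadamard inverse (for instance
  for size 1 the zero matrix would be admitted). We therefore require every entry in
  the triangle to be nonzero, which for all other entries already follows from the ratio
  conditions (recall \<open>x / 0 = 0\<close>).
\<close>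

definition L_CoLT :: "nat \<Rightarrow> real mat set" where
  "L_CoLT N = {M \<in> carrier_mat N N.
     (\<forall>i<N. \<forall>j<N. i < j \<longrightarrow> M $$ (i, j) = 0) \<and>
     (\<forall>i<N. \<forall>j<N. j \<le> i \<longrightarrow> M $$ (i, j) \<noteq> 0) \<and>
     (\<exists>r \<in> carrier_vec (N - 1).
        (\<forall>i < N - 1. r $ i \<noteq> 0) \<and>
        (\<forall>i < N - 1. \<forall>j \<le> i. M $$ (i + 1, j) / M $$ (i, j) = r $ i))}"

text \<open>
  In the ratio condition below, the row index \<open>i\<close> is that of the numerator, i.e. one less
  than that of the denominator; this is also the index of the ratio.
\<close>

definition U_CoLT :: "nat \<Rightarrow> real mat set" where
  "U_CoLT N = {M \<in> carrier_mat N N.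
     (\<forall>i<N. \<forall>j<N. j \<le> i \<longrightarrow> M $$ (i, j) = 0) \<and>
     (\<forall>i<N. \<forall>j<N. i < j \<longrightarrow> M $$ (i, j) \<noteq> 0) \<and>
     (\<exists>r \<in> carrier_vec (N - 2).
        (\<forall>i < N - 2. r $ i \<noteq> 0) \<and>
        (\<forall>i < N - 2. \<forall>j<N. i + 1 < j \<longrightarrow> M $$ (i, j) / M $$ (i + 1, j) = r $ i))}"

definition CoLT :: "nat \<Rightarrow> real mat set" where
  "CoLT N = {A + B | A B. A \<in> L_CoLT N \<and> B \<in> U_CoLT N}"

definition hadamard :: "'a::times mat \<Rightarrow> 'a mat \<Rightarrow> 'a mat" (infixl \<open>\<odot>\<close> 70) where
  "A \<odot> B = mat (dim_row A) (dim_col A) (\<lambda>ij. A $$ ij * B $$ ij)"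

definition ones_mat :: "nat \<Rightarrow> 'a::one mat" where
  "ones_mat N = mat N N (\<lambda>_. 1)"

end

theory Submission
  imports Defs
begin

text \<open>
  A matrix lies in \<open>CoLT N\<close> iff all its entries are nonzero and consecutive rows are proportional
  on the lower triangle and on the strict upper triangle. All these conditions are preserved by
  entrywise products and inverses, so \<open>CoLT N\<close> is a subgroup of the Hadamard group of matrices
  without zero entries.
\<close>

text \<open>The two summands have disjoint supports, so each can be read off from the sum by
  restricting to its triangle. Clearing denominators turns the ratios into equations
  \<open>x = r * y\<close>, which pass through entrywise products and inverses. Nonzero entries
  force the factors to be nonzero, and the bounds \<open>i + 1 < j\<close> and \<open>j < N\<close>
  already give \<open>i < N - 2\<close>.\<close>

lemma CoLT_iff:
  "M \<in> CoLT N \<longleftrightarrow> M \<in> carrier_mat N N \<and> (\<forall>i<N. \<forall>j<N. M $$ (i, j) \<noteq> 0) \<and>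
     (\<exists>r. \<forall>i j. i + 1 < N \<longrightarrow> j \<le> i \<longrightarrow> M $$ (i + 1, j) = r i * M $$ (i, j)) \<and>
     (\<exists>s. \<forall>i j. i + 1 < j \<longrightarrow> j < N \<longrightarrow> M $$ (i, j) = s i * M $$ (i + 1, j))"
  (is "_ \<longleftrightarrow> ?R")
proof
  assume "M \<in> CoLT N"
  then obtain A B where AB: "A \<in> L_CoLT N" "B \<in> U_CoLT N" and M: "M = A + B"
    by (auto simp: CoLT_def)
  from AB(1) obtain r where "A \<in> carrier_mat N N"
      "\<forall>i<N. \<forall>j<N. i < j \<longrightarrow> A $$ (i, j) = 0"
      "\<forall>i<N. \<forall>j<N. j \<le> i \<longrightarrow> A $$ (i, j) \<noteq> 0"
      "\<forall>i < N - 1. \<forall>j \<le> i. A $$ (i + 1, j) / A $$ (i, j) = r $ i"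
    unfolding L_CoLT_def by (elim CollectE conjE bexE) (rule that)
  note A = this[rule_format]
  from AB(2) obtain s where "B \<in> carrier_mat N N"
      "\<forall>i<N. \<forall>j<N. j \<le> i \<longrightarrow> B $$ (i, j) = 0"
      "\<forall>i<N. \<forall>j<N. i < j \<longrightarrow> B $$ (i, j) \<noteq> 0"
      "\<forall>i < N - 2. \<forall>j<N. i + 1 < j \<longrightarrow> B $$ (i, j) / B $$ (i + 1, j) = s $ i"
    unfolding U_CoLT_def by (elim CollectE conjE bexE) (rule that)
  note B = this[rule_format]
  \<comment> \<open>On each triangle the other summand vanishes, so \<open>M\<close> inherits the
    entries of one summand unchanged.\<close>
  have lower: "M $$ (i, j) = A $$ (i, j)" if "i < N" "j \<le> i" for i j
    using that A(1) B(1) B(2)[of i j] by (simp add: M)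
  have upper: "M $$ (i, j) = B $$ (i, j)" if "i < j" "j < N" for i j
    using that A(1) A(2)[of i j] B(1) by (simp add: M)
  show ?R
  proof (intro conjI allI impI exI)
    show "M \<in> carrier_mat N N" using A(1) B(1) by (simp add: M)
  next
    fix i j assume "i < N" "j < N"
    then show "M $$ (i, j) \<noteq> 0"
      using A(3)[of i j] B(3)[of i j] lower[of i j] upper[of i j] by (cases "j \<le> i") auto
  next
    fix i j assume "i + 1 < N" "j \<le> i"
    then show "M $$ (i + 1, j) = r $ i * M $$ (i, j)"
      using A(3)[of i j] A(4)[of i j] by (simp add: lower field_simps)
  next
    \<comment> \<open>The denominator sits at row \<open>i + 1\<close>, still strictly above the
      diagonal, so it is nonzero and can be cleared.\<close>
    fix i j assume "i + 1 < j" "j < N"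
    then show "M $$ (i, j) = s $ i * M $$ (i + 1, j)"
      using B(3)[of "i + 1" j] B(4)[of i j] by (simp add: upper field_simps)
  qed
next
  assume ?R
  then obtain r s where "M \<in> carrier_mat N N"
      "\<forall>i<N. \<forall>j<N. M $$ (i, j) \<noteq> 0"
      "\<forall>i j. i + 1 < N \<longrightarrow> j \<le> i \<longrightarrow> M $$ (i + 1, j) = r i * M $$ (i, j)"
      "\<forall>i j. i + 1 < j \<longrightarrow> j < N \<longrightarrow> M $$ (i, j) = s i * M $$ (i + 1, j)"
    by (elim conjE exE) (rule that)
  note M = this(1) and nz = this(2)[rule_format] and r = this(3)[rule_format]
    and s = this(4)[rule_format]
  define A where "A = mat N N (\<lambda>(i, j). if j \<le> i then M $$ (i, j) else 0)"
  define B where "B = mat N N (\<lambda>(i, j). if i < j then M $$ (i, j) else 0)"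
  \<comment> \<open>Column 0 meets the lower triangle in every row; a zero factor would annihilate
    the entry \<open>(i + 1, 0)\<close>.\<close>
  have r_nz: "r i \<noteq> 0" if "i < N - 1" for i
    using that r[of i 0] nz[of "i + 1" 0] by auto
  \<comment> \<open>Column \<open>i + 2\<close> is the first one strictly above the diagonal in both
    rows \<open>i\<close> and \<open>i + 1\<close>; a zero factor would annihilate the entry
    \<open>(i, i + 2)\<close>.\<close>
  have s_nz: "s i \<noteq> 0" if "i < N - 2" for i
    using that s[of i "i + 2"] nz[of i "i + 2"] by auto
  have "A \<in> L_CoLT N"
    unfolding L_CoLT_def
  proof (intro CollectI conjI bexI[where x = "vec (N - 1) r"] allI impI)
    fix i j assume "i < N - 1" "j \<le> i"
    then show "A $$ (i + 1, j) / A $$ (i, j) = vec (N - 1) r $ i"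
      using r[of i j] nz[of i j] by (simp add: A_def)
  qed (auto simp: A_def nz r_nz)
  moreover have "B \<in> U_CoLT N"
    unfolding U_CoLT_def
  proof (intro CollectI conjI bexI[where x = "vec (N - 2) s"] allI impI)
    fix i j assume "i < N - 2" "j < N" "i + 1 < j"
    then show "B $$ (i, j) / B $$ (i + 1, j) = vec (N - 2) s $ i"
      using s[of i j] nz[of "i + 1" j] by (simp add: B_def)
  qed (auto simp: B_def nz s_nz)
  moreover have "M = A + B"
    using M by (intro eq_matI) (auto simp: A_def B_def)
  ultimately show "M \<in> CoLT N" by (auto simp: CoLT_def)
qed

lemma CoLT_carrier: "M \<in> CoLT N \<Longrightarrow> M \<in> carrier_mat N N"
  by (simp add: CoLT_iff)

lemma ones_mat_in_CoLT: "ones_mat N \<in> CoLT N"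
  by (auto simp: CoLT_iff ones_mat_def intro!: exI[where x = "\<lambda>_. 1"])

text \<open>The row factors of a product are the products of the row factors.\<close>

lemma hadamard_in_CoLT:
  assumes "A \<in> CoLT N" "B \<in> CoLT N"
  shows "A \<odot> B \<in> CoLT N"
proof -
  obtain r s where "A \<in> carrier_mat N N" "\<forall>i<N. \<forall>j<N. A $$ (i, j) \<noteq> 0"
      "\<forall>i j. i + 1 < N \<longrightarrow> j \<le> i \<longrightarrow> A $$ (i + 1, j) = r i * A $$ (i, j)"
      "\<forall>i j. i + 1 < j \<longrightarrow> j < N \<longrightarrow> A $$ (i, j) = s i * A $$ (i + 1, j)"
    using assms(1) unfolding CoLT_iff by (elim conjE exE) (rule that)
  note A = this[rule_format]
  obtain r' s' where "B \<in> carrier_mat N N" "\<forall>i<N. \<forall>j<N. B $$ (i, j) \<noteq> 0"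
      "\<forall>i j. i + 1 < N \<longrightarrow> j \<le> i \<longrightarrow> B $$ (i + 1, j) = r' i * B $$ (i, j)"
      "\<forall>i j. i + 1 < j \<longrightarrow> j < N \<longrightarrow> B $$ (i, j) = s' i * B $$ (i + 1, j)"
    using assms(2) unfolding CoLT_iff by (elim conjE exE) (rule that)
  note B = this[rule_format]
  have entry: "(A \<odot> B) $$ (i, j) = A $$ (i, j) * B $$ (i, j)" if "i < N" "j < N" for i j
    using that A(1) by (simp add: hadamard_def)
  show ?thesis
    unfolding CoLT_iff
  proof (intro conjI allI impI exI)
    show "A \<odot> B \<in> carrier_mat N N" using A(1) by (simp add: hadamard_def)
  next
    fix i j assume "i < N" "j < N"
    then show "(A \<odot> B) $$ (i, j) \<noteq> 0" using A(2) B(2) by (simp add: entry)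
  next
    fix i j assume "i + 1 < N" "j \<le> i"
    then show "(A \<odot> B) $$ (i + 1, j) = (r i * r' i) * (A \<odot> B) $$ (i, j)"
      using A(3)[of i j] B(3)[of i j] by (simp add: entry)
  next
    fix i j assume "i + 1 < j" "j < N"
    then show "(A \<odot> B) $$ (i, j) = (s i * s' i) * (A \<odot> B) $$ (i + 1, j)"
      using A(4)[of i j] B(4)[of i j] by (simp add: entry)
  qed
qed

text \<open>Entrywise inversion replaces each row factor by its inverse, since
  \<open>inverse\<close> is multiplicative on the reals.\<close>

lemma map_mat_inverse_in_CoLT:
  assumes "A \<in> CoLT N"
  shows "map_mat inverse A \<in> CoLT N"
proof -
  obtain r s where "A \<in> carrier_mat N N" "\<forall>i<N. \<forall>j<N. A $$ (i, j) \<noteq> 0"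
      "\<forall>i j. i + 1 < N \<longrightarrow> j \<le> i \<longrightarrow> A $$ (i + 1, j) = r i * A $$ (i, j)"
      "\<forall>i j. i + 1 < j \<longrightarrow> j < N \<longrightarrow> A $$ (i, j) = s i * A $$ (i + 1, j)"
    using assms unfolding CoLT_iff by (elim conjE exE) (rule that)
  note A = this[rule_format]
  have entry: "map_mat inverse A $$ (i, j) = inverse (A $$ (i, j))" if "i < N" "j < N" for i j
    using that A(1) by simp
  show ?thesis
    unfolding CoLT_iff
  proof (intro conjI allI impI exI)
    show "map_mat inverse A \<in> carrier_mat N N" using A(1) by simp
  next
    fix i j assume "i < N" "j < N"
    then show "map_mat inverse A $$ (i, j) \<noteq> 0" using A(2) by (simp add: entry)
  next
    fix i j assume "i + 1 < N" "j \<le> i"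
    then show "map_mat inverse A $$ (i + 1, j) = inverse (r i) * map_mat inverse A $$ (i, j)"
      using A(3)[of i j] by (simp add: entry)
  next
    fix i j assume "i + 1 < j" "j < N"
    then show "map_mat inverse A $$ (i, j) = inverse (s i) * map_mat inverse A $$ (i + 1, j)"
      using A(4)[of i j] by (simp add: entry)
  qed
qed

text \<open>A product takes its shape from its left factor, so \<open>B \<odot> C\<close> has its
  expected entries only within the dimensions of \<open>B\<close>, which must therefore match those
  of \<open>A\<close>.\<close>

lemma hadamard_assoc:
  fixes A B C :: "'a::semigroup_mult mat"
  assumes "A \<in> carrier_mat m n" "B \<in> carrier_mat m n"
  shows "A \<odot> B \<odot> C = A \<odot> (B \<odot> C)"
  using assms by (intro eq_matI) (auto simp: hadamard_def mult.assoc)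

lemma hadamard_commute:
  fixes A B :: "'a::ab_semigroup_mult mat"
  assumes "A \<in> carrier_mat m n" "B \<in> carrier_mat m n"
  shows "A \<odot> B = B \<odot> A"
  using assms by (intro eq_matI) (auto simp: hadamard_def mult.commute)

lemma ones_mat_hadamard:
  fixes A :: "'a::monoid_mult mat"
  assumes "A \<in> carrier_mat N N"
  shows "ones_mat N \<odot> A = A"
  using assms by (intro eq_matI) (auto simp: hadamard_def ones_mat_def)

lemma map_mat_inverse_hadamard:
  assumes "A \<in> CoLT N"
  shows "map_mat inverse A \<odot> A = ones_mat N"
  using assms by (intro eq_matI) (auto simp: CoLT_iff hadamard_def ones_mat_def)

theorem corollary3p5:
  fixes N :: nat
  shows "comm_group \<lparr>carrier = CoLT N, monoid.mult = (\<odot>), one = ones_mat N\<rparr>"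
\<comment> \<open>By commutativity, a left identity and left inverses suffice; the inverse of
  \<open>A\<close> is \<open>map_mat inverse A\<close>.\<close>
proof (rule comm_groupI; simp)
  show "A \<odot> B \<odot> C = A \<odot> (B \<odot> C)" if "A \<in> CoLT N" "B \<in> CoLT N" "C \<in> CoLT N" for A B C
    using that hadamard_assoc CoLT_carrier by blast
  show "A \<odot> B = B \<odot> A" if "A \<in> CoLT N" "B \<in> CoLT N" for A B
    using that hadamard_commute CoLT_carrier by blast
  show "\<exists>B\<in>CoLT N. B \<odot> A = ones_mat N" if "A \<in> CoLT N" for A
    using that map_mat_inverse_in_CoLT map_mat_inverse_hadamard by blast
qed (simp_all add: ones_mat_in_CoLT hadamard_in_CoLT ones_mat_hadamard CoLT_carrier)

end
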